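(* Let $(\Omega,\mathcal{F},P)$ be a probability space, $\Theta\subset\mathbb{R}$, let $\boldsymbol{R}(\theta,\omega)$ be a random routing table depending on $\theta\in\Theta$, let $\mathcal{R}$ be the set of all possible routing tables (the possible values of $\boldsymbol{R}(\theta,\omega)$), and for each $R\in\mathcal{R}$ let $F_R(\theta,\omega)=F(\theta,\omega,R)$ be a real-valued function on $\Theta\times\Omega$ which is $\mathcal{F}$-measurable in $\omega$ for every $\theta\in\Theta$. Suppose that the random performance criterion $F$ is represented in the form $$F(\theta,\omega,\boldsymbol{R}(\theta,\omega))=\sum_{R\in\mathcal{R}}\mathbf{1}_{\{\boldsymbol{R}(\theta,\omega)=R\}}F_R(\theta,\omega),$$ and that for each $R\in\mathcal{R}$ the following conditions hold: (i) for every $\theta\in\Theta$ the derivative $\frac{\partial}{\partial\theta}F_R(\theta,\omega)$ exists at $\theta$ with probability one; and there is a random variable $\lambda(\omega)$ with $E\lambda<\infty$ such that for all $\theta_1,\theta_2\in\Theta$, $$|F_R(\theta_1,\omega)-F_R(\theta_2,\omega)|\le\lambda(\omega)\,|\theta_1-\theta_2|\quad\text{with probability one};$$ (ii) for any $\theta\in\Theta$, the random variable $F_R(\theta,\omega)$ and the random matrix $\boldsymbol{R}(\theta,\omega)$ are independent; (iii) for any $\theta\in\Theta$, the function $\Phi(\theta,R)=\Pr\{\boldsymbol{R}(\theta,\omega)=R\}$ is continuously differentiable at $\theta$, and $\Phi(\theta,R)>0$. For $\theta_0\in\Theta$ define $$G(\theta_0,\omega)=\left.\frac{\partial}{\partial\theta}F(\theta,\omega,\boldsymbol{R}(\theta_0,\omega))\right|_{\theta=\theta_0}+F(\theta_0,\omega,\boldsymbol{R}(\theta_0,\omega))\,\Psi(\theta_0,\boldsymbol{R}(\theta_0,\omega)),$$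 where $\Psi(\theta,R)=\frac{\partial}{\partial\theta}\ln\Phi(\theta,R)$. Then for any $\theta_0\in\Theta$, the estimate $$\widetilde g(\theta_0,\omega_1,\ldots,\omega_M)=\frac1M\sum_{i=1}^{M}G(\theta_0,\omega_i),$$ where $\omega_1,\ldots,\omega_M$ are independent realizations of $\omega$, is an unbiased estimate of the gradient $\left.\frac{\partial}{\partial\theta}E[F(\theta,\omega,\boldsymbol{R}(\theta,\omega))]\right|_{\theta=\theta_0}$, that is, $$E\big[\widetilde g(\theta_0,\omega_1,\ldots,\omega_M)\big]=\left.\frac{\partial}{\partial\theta}E[F(\theta,\omega,\boldsymbol{R}(\theta,\omega))]\right|_{\theta=\theta_0}.$$
   Context: Setting: a queueing network with $N$ nodes. A routing table is a matrix $R$ with $N$ rows and columns indexed by $k=1,2,\ldots$, with entries in $\{1,\ldots,N\}$; the entry in row $n$ and column $k$ is the next node to be visited by the customer who is the $k$th to depart from node $n$. The parameter $\theta\in\Theta\subset\mathbb{R}$ is a decision parameter and $\omega$ represents the random effects in the network behaviour. With parameter-dependent probabilistic routing, the entries $\rho_n^k(\theta,\omega)$ are discrete random variables with values in $\{1,\ldots,N\}$, so that $\boldsymbol{R}(\theta,\omega)=(\rho_n^k(\theta,\omega))$ is a random matrix whose values are particular routing tables; $\mathcal{R}$ denotes the set of all possible routing tables. For $R\in\mathcal{R}$, $F_R(\theta,\omega)=F(\theta,\omega,R)$ is the (real-valued, random) performance criterion evaluated under the condition that the network operates according to the deterministic routing given by $R$. $\mathbf{1}_{\{\cdot\}}$ is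 the indicator function of an event. The performance measure associated with $F$ is the expected value $E[F(\theta,\omega,\boldsymbol{R}(\theta,\omega))]$, the expectation being taken over $\omega$. In the first term of $G(\theta_0,\omega)$ the routing table is held fixed at $\boldsymbol{R}(\theta_0,\omega)$ and the differentiation in $\theta$ acts only on the first argument of $F$.
   Formalization: Added: the derivative of F_R at θ0 is independent of R(θ0,ω); if the set of tables is infinite, the increments of the terms Φ(θ,R)E[F_R] have a summable majorant near θ0; E[F] exists; every point of Θ is a limit point of Θ. Without the first two the claim fails. *)

theory Defs
  imports "HOL-Probability.Probability"
begin

text \<open>
  Row \<open>n \<in> {1..N}\<close>, column \<open>k \<ge> 1\<close>. Tables are extensional functions, so that equality of
  tables is equality of all their entries.
\<close>

type_synonym table = "nat \<Rightarrow> nat \<Rightarrow> nat"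

text \<open>
  Measurability of a table-valued map into \<open>table_space N\<close> says that every entry is a discrete
  random variable with values in \<open>{1..N}\<close>.
\<close>

definition table_space :: "nat \<Rightarrow> table measure" where
  "table_space N = (\<Pi>\<^sub>M n\<in>{1..N}. \<Pi>\<^sub>M k\<in>{1..}. count_space {1..N})"

definition possible_tables :: "'w measure \<Rightarrow> real set \<Rightarrow> (real \<Rightarrow> 'w \<Rightarrow> table) \<Rightarrow> table set" where
  "possible_tables P \<Theta> Rt = (\<Union>\<theta>\<in>\<Theta>. Rt \<theta> ` space P)"

definition table_prob :: "'w measure \<Rightarrow> (real \<Rightarrow> 'w \<Rightarrow> table) \<Rightarrow> real \<Rightarrow> table \<Rightarrow> real" where
  "table_prob P Rt \<theta> R = measure P {\<omega> \<in> space P. Rt \<theta> \<omega> = R}"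

text \<open>
  The library constant \<open>indep_var\<close> requires both variables to have the same type; this is the
  same notion for variables of two different types.
\<close>

definition indep_rv ::
  "'w measure \<Rightarrow> 'a measure \<Rightarrow> ('w \<Rightarrow> 'a) \<Rightarrow> 'b measure \<Rightarrow> ('w \<Rightarrow> 'b) \<Rightarrow> bool" where
  "indep_rv P A X B Y \<longleftrightarrow> X \<in> P \<rightarrow>\<^sub>M A \<and> Y \<in> P \<rightarrow>\<^sub>M B \<and>
     prob_space.indep_set P {X -` U \<inter> space P |U. U \<in> sets A} {Y -` V \<inter> space P |V. V \<in> sets B}"

text \<open>
  The functions of the parameter are meaningful on \<open>\<Theta>\<close> only, so all derivatives are taken within
  \<open>\<Theta>\<close>; for open \<open>\<Theta>\<close> they are the ordinary ones. The constant \<open>vector_derivative\<close>, applied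
  to a real function of a real variable, is its derivative.
\<close>

definition score ::
  "'w measure \<Rightarrow> real set \<Rightarrow> (real \<Rightarrow> 'w \<Rightarrow> table) \<Rightarrow> real \<Rightarrow> table \<Rightarrow> real" where
  "score P \<Theta> Rt \<theta> R =
     vector_derivative (\<lambda>t. ln (table_prob P Rt t R)) (at \<theta> within \<Theta>)"

text \<open>
  The derivative of \<open>F\<close> exists only almost surely, so \<open>grad_sample\<close> is determined, and need be
  measurable, only up to a null set. Independence statements about that derivative and expectations
  of \<open>grad_sample\<close> are therefore to be taken with respect to the completed measures.

  Independence of \<open>F\<^sub>R(\<theta>)\<close> and the table at \<open>\<theta>\<close>, separately for each \<open>\<theta>\<close>, does not make the
  derivative of \<open>F\<^sub>R\<close> at \<open>\<theta>0\<close> independent of the table at \<open>\<theta>0\<close>: for \<open>F\<^sub>R(\<theta>) = \<theta>X\<close> and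
  \<open>\<theta>0 = 0\<close> it says nothing about \<open>X\<close> and the table at \<open>0\<close>. The latter independence has to be
  required as well.
\<close>

definition grad_sample ::
  "'w measure \<Rightarrow> real set \<Rightarrow> (real \<Rightarrow> 'w \<Rightarrow> table \<Rightarrow> real) \<Rightarrow> (real \<Rightarrow> 'w \<Rightarrow> table)
     \<Rightarrow> real \<Rightarrow> 'w \<Rightarrow> real" where
  "grad_sample P \<Theta> F Rt \<theta>0 \<omega> =
     vector_derivative (\<lambda>\<theta>. F \<theta> \<omega> (Rt \<theta>0 \<omega>)) (at \<theta>0 within \<Theta>)
     + F \<theta>0 \<omega> (Rt \<theta>0 \<omega>) * score P \<Theta> Rt \<theta>0 (Rt \<theta>0 \<omega>)"

definition grad_estimate ::
  "'w measure \<Rightarrow> real set \<Rightarrow> (real \<Rightarrow> 'w \<Rightarrow> table \<Rightarrow> real) \<Rightarrow> (real \<Rightarrow> 'w \<Rightarrow> table)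
     \<Rightarrow> real \<Rightarrow> nat \<Rightarrow> (nat \<Rightarrow> 'w) \<Rightarrow> real" where
  "grad_estimate P \<Theta> F Rt \<theta>0 m w = (1 / real m) * (\<Sum>i=1..m. grad_sample P \<Theta> F Rt \<theta>0 (w i))"

text \<open>
  A summable majorant near \<open>\<theta>0\<close> for the increments of the terms
  \<open>\<Phi>(\<theta>, R) E[F\<^sub>R(\<theta>)]\<close>, where \<open>lam R\<close> is a Lipschitz bound for \<open>F\<^sub>R\<close>. It justifies
  termwise differentiation of an infinite sum over \<open>R\<close>, without which the gradient formula fails:
  for \<open>F = 1\<close> it would assert that the derivatives of the probabilities \<open>\<Phi>(\<cdot>, R)\<close> sum to zero,
  which continuous differentiability of each of them does not give.
\<close>

definition terms_dominated ::
  "'w measure \<Rightarrow> real set \<Rightarrow> (real \<Rightarrow> 'w \<Rightarrow> table \<Rightarrow> real) \<Rightarrow> (real \<Rightarrow> 'w \<Rightarrow> table)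
     \<Rightarrow> (table \<Rightarrow> 'w \<Rightarrow> real) \<Rightarrow> real \<Rightarrow> bool" where
  "terms_dominated P \<Theta> F Rt lam \<theta>0 \<longleftrightarrow>
     (\<exists>b \<delta>. \<delta> > 0 \<and> b summable_on possible_tables P \<Theta> Rt \<and>
       (\<forall>R\<in>possible_tables P \<Theta> Rt. \<forall>\<theta>\<in>\<Theta>. \<bar>\<theta> - \<theta>0\<bar> < \<delta> \<longrightarrow>
          table_prob P Rt \<theta> R * (\<integral>\<omega>. lam R \<omega> \<partial>P) \<le> b R \<and>
          \<bar>table_prob P Rt \<theta> R - table_prob P Rt \<theta>0 R\<bar> * (\<integral>\<omega>. \<bar>F \<theta>0 \<omega> R\<bar> \<partial>P)
            \<le> b R * \<bar>\<theta> - \<theta>0\<bar>))"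

end

theory Submission
  imports Defs
begin

text \<open>
  Every table in \<open>\<R>\<close> has positive probability at \<open>\<theta>0\<close>, so \<open>\<R>\<close> is countable and the events
  \<open>{R(\<theta>) = R}\<close> form a countable measurable partition of \<open>\<Omega>\<close>. Fubini for the counting measure on
  \<open>\<R>\<close> and independence turn \<open>E[F(\<theta>, \<omega>, R(\<theta>, \<omega>))]\<close> into the series
  \<open>\<Sum>\<^sub>R \<Phi>(\<theta>, R) E[F\<^sub>R(\<theta>)]\<close>. The Lipschitz bound \<open>\<lambda>\<^sub>R\<close> allows differentiating each
  \<open>E[F\<^sub>R(\<theta>)]\<close> under the expectation, and the majorant of the increments allows differentiating the
  series term by term; both are the same dominated convergence argument, for \<open>P\<close> and for the counting
  measure. The derivative of \<open>\<Phi>(\<cdot>, R)\<close> is \<open>\<Phi>(\<theta>0, R) \<Psi>(\<theta>0, R)\<close>, so the resulting series is the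
  decomposition of \<open>E[G(\<theta>0, \<omega>)]\<close> along the same partition.
\<close>

section \<open>Measurability of a single routing table\<close>

text \<open>An extensional function is the only point of the box with sides \<open>{f i}\<close>,
  and a box with countably many measurable sides is measurable. Applied to rows and to columns, this
  makes the event of one particular table measurable although a table has infinitely many
  entries.\<close>

lemma singleton_in_sets_PiM:
  assumes "countable I" and "f \<in> space (PiM I M)" and "\<And>i. i \<in> I \<Longrightarrow> {f i} \<in> sets (M i)"
  shows "{f} \<in> sets (PiM I M)"
proof -
  have "f \<in> extensional I"
    using assms(2) by (auto simp: space_PiM PiE_def)
  then show ?thesis
    using sets_PiM_I_countable[OF assms(1), of "\<lambda>i. {f i}" M] assms(3) by (simp add: PiE_singleton)
qed

lemma singleton_in_sets_table_space:
  assumes "R \<in> space (table_space N)"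
  shows "{R} \<in> sets (table_space N)"
  using assms unfolding table_space_def
  by (intro singleton_in_sets_PiM) (auto simp: space_PiM PiE_iff)

section \<open>Integration along a countable measurable partition\<close>

context
  fixes M :: "'a measure" and I :: "'i set" and Y :: "'a \<Rightarrow> 'i" and g :: "'i \<Rightarrow> 'a \<Rightarrow> real"
  assumes M: "sigma_finite_measure M" and I: "countable I"
    and Y: "Y \<in> M \<rightarrow>\<^sub>M count_space I"
    and g: "\<And>i. i \<in> I \<Longrightarrow> g i \<in> borel_measurable M"
begin

interpretation pair_sigma_finite "count_space I" M
  using M I by (simp add: pair_sigma_finite_def sigma_finite_measure_count_space_countable)

lemma partition_term_measurable:
  assumes "i \<in> I"
  shows "(\<lambda>\<omega>. indicator (Y -` {i} \<inter> space M) \<omega> * g i \<omega>) \<in> borel_measurable M"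
  using g[OF assms] measurable_sets[OF Y, of "{i}"] assms by auto

lemma partition_pair_measurable:
  "(\<lambda>(i, \<omega>). indicator (Y -` {i} \<inter> space M) \<omega> * g i \<omega>)
     \<in> borel_measurable (count_space I \<Otimes>\<^sub>M M)"
  by (rule measurable_pair_measure_countable1[OF I]) (use partition_term_measurable in simp)

text \<open>Only the index \<open>Y \<omega>\<close> can contribute at a given point, and it lies in
  \<open>I\<close> because \<open>Y\<close> maps into \<open>count_space I\<close>.\<close>

lemma partition_sum:
  assumes "\<omega> \<in> space M"
  shows "integrable (count_space I) (\<lambda>i. indicator (Y -` {i} \<inter> space M) \<omega> * g i \<omega>)"
    and "(\<integral>i. indicator (Y -` {i} \<inter> space M) \<omega> * g i \<omega> \<partial>count_space I) = g (Y \<omega>) \<omega>"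
    and "(\<integral>i. \<bar>indicator (Y -` {i} \<inter> space M) \<omega> * g i \<omega>\<bar> \<partial>count_space I) = \<bar>g (Y \<omega>) \<omega>\<bar>"
proof -
  have YI: "Y \<omega> \<in> I"
    using measurable_space[OF Y assms] by simp
  have eq: "indicator (Y -` {i} \<inter> space M) \<omega> * g i \<omega> = indicator {Y \<omega>} i * g (Y \<omega>) \<omega>" for i
    using assms by (auto simp: indicator_def)
  show "integrable (count_space I) (\<lambda>i. indicator (Y -` {i} \<inter> space M) \<omega> * g i \<omega>)"
    unfolding eq using YI by (intro integrable_mult_left integrable_real_indicator) auto
  show "(\<integral>i. indicator (Y -` {i} \<inter> space M) \<omega> * g i \<omega> \<partial>count_space I) = g (Y \<omega>) \<omega>"
    "(\<integral>i. \<bar>indicator (Y -` {i} \<inter> space M) \<omega> * g i \<omega>\<bar> \<partial>count_space I) = \<bar>g (Y \<omega>) \<omega>\<bar>"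
    unfolding eq using YI by (simp_all add: abs_mult)
qed

text \<open>Fubini on the product of the counting measure and \<open>M\<close>: summable absolute
  integrals over the cells give integrability on the product, and integrating the index out leaves
  \<open>g (Y \<omega>) \<omega>\<close>. This route also supplies the measurability of that
  function.\<close>

lemma integrable_partition:
  assumes "\<And>i. i \<in> I \<Longrightarrow> integrable M (\<lambda>\<omega>. indicator (Y -` {i} \<inter> space M) \<omega> * g i \<omega>)"
    and "integrable (count_space I) (\<lambda>i. \<integral>\<omega>. \<bar>indicator (Y -` {i} \<inter> space M) \<omega> * g i \<omega>\<bar> \<partial>M)"
  shows "integrable M (\<lambda>\<omega>. g (Y \<omega>) \<omega>)"
proof -
  have "integrable (count_space I \<Otimes>\<^sub>M M) (\<lambda>(i, \<omega>). indicator (Y -` {i} \<inter> space M) \<omega> * g i \<omega>)"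
    using assms by (intro Fubini_integrable[OF partition_pair_measurable]) (auto simp: AE_count_space)
  from integrable_snd[OF this] show ?thesis
    by (rule Bochner_Integration.integrable_cong[THEN iffD1, rotated 2]) (simp_all add: partition_sum)
qed

text \<open>The converse direction. When the index is integrated out first, the absolute terms add
  up to the absolute value of \<open>g (Y \<omega>) \<omega>\<close>, so integrability of this
  function alone gives integrability on the product; the rest is Fubini in the other order.\<close>

lemma
  assumes "integrable M (\<lambda>\<omega>. g (Y \<omega>) \<omega>)"
  shows integrable_partition_term:
      "i \<in> I \<Longrightarrow> integrable M (\<lambda>\<omega>. indicator (Y -` {i} \<inter> space M) \<omega> * g i \<omega>)"
    and integrable_partition_integrals:
      "integrable (count_space I) (\<lambda>i. \<integral>\<omega>. indicator (Y -` {i} \<inter> space M) \<omega> * g i \<omega> \<partial>M)"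
    and integral_partition:
      "(\<integral>\<omega>. g (Y \<omega>) \<omega> \<partial>M)
         = (\<integral>i. (\<integral>\<omega>. indicator (Y -` {i} \<inter> space M) \<omega> * g i \<omega> \<partial>M) \<partial>count_space I)"
proof -
  interpret Q: pair_sigma_finite M "count_space I" ..
  have "(\<lambda>(i, \<omega>). indicator (Y -` {i} \<inter> space M) \<omega> * g i \<omega>)
      \<in> borel_measurable (count_space I \<Otimes>\<^sub>M M)"
    by (rule partition_pair_measurable)
  from measurable_pair_swap[OF this]
  have meas: "(\<lambda>(\<omega>, i). indicator (Y -` {i} \<inter> space M) \<omega> * g i \<omega>)
      \<in> borel_measurable (M \<Otimes>\<^sub>M count_space I)"
    by simp
  have "integrable M (\<lambda>\<omega>. \<integral>i. norm (indicator (Y -` {i} \<inter> space M) \<omega> * g i \<omega>) \<partial>count_space I)"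
    by (rule Bochner_Integration.integrable_cong[THEN iffD2, OF refl _ integrable_norm[OF assms]])
      (simp add: partition_sum(3))
  then have "integrable (M \<Otimes>\<^sub>M count_space I) (\<lambda>(\<omega>, i). indicator (Y -` {i} \<inter> space M) \<omega> * g i \<omega>)"
    using partition_sum(1) by (intro Q.Fubini_integrable[OF meas]) auto
  from Q.integrable_product_swap[OF this]
  have int: "integrable (count_space I \<Otimes>\<^sub>M M) (\<lambda>(i, \<omega>). indicator (Y -` {i} \<inter> space M) \<omega> * g i \<omega>)"
    by simp
  \<comment> \<open>Fubini speaks of almost every section; each point of \<open>I\<close> has mass
    one under \<open>count_space I\<close>, so no index is lost.\<close>
  show "i \<in> I \<Longrightarrow> integrable M (\<lambda>\<omega>. indicator (Y -` {i} \<inter> space M) \<omega> * g i \<omega>)"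
    using AE_integrable_fst[OF int] by (simp add: AE_count_space)
  show "integrable (count_space I) (\<lambda>i. \<integral>\<omega>. indicator (Y -` {i} \<inter> space M) \<omega> * g i \<omega> \<partial>M)"
    by (rule integrable_fst[OF int])
  show "(\<integral>\<omega>. g (Y \<omega>) \<omega> \<partial>M)
         = (\<integral>i. (\<integral>\<omega>. indicator (Y -` {i} \<inter> space M) \<omega> * g i \<omega> \<partial>M) \<partial>count_space I)"
    unfolding Fubini_integral[OF int, symmetric]
    by (rule Bochner_Integration.integral_cong) (simp_all add: partition_sum)
qed

end

section \<open>Independence of a random variable and an event\<close>

lemma (in prob_space)
  fixes X :: "'a \<Rightarrow> real"
  assumes X[measurable]: "X \<in> borel_measurable M" and E[measurable]: "E \<in> events"
    and indep: "\<And>U. U \<in> sets borel \<Longrightarrow> prob (X -` U \<inter> space M \<inter> E) = prob (X -` U \<inter> space M) * prob E"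
  shows integrable_indep_event_iff:
      "integrable M (\<lambda>\<omega>. indicator E \<omega> * X \<omega>) \<longleftrightarrow> integrable M (\<lambda>\<omega>. prob E * X \<omega>)"
    and integral_indep_event:
      "(\<integral>\<omega>. indicator E \<omega> * X \<omega> \<partial>M) = prob E * (\<integral>\<omega>. X \<omega> \<partial>M)"
proof -
  \<comment> \<open>Both claims are read off one identity between the law of \<open>X\<close> under \<open>M\<close> restricted to
    \<open>E\<close> and a multiple of the law of \<open>X\<close>.\<close>
  let ?A = "distr (density M (\<lambda>\<omega>. ennreal (indicator E \<omega>))) borel X"
  let ?B = "density (distr M borel X) (\<lambda>_. ennreal (prob E))"
  have eq: "?A = ?B"
  proof (rule measure_eqI)
    fix U :: "real set" assume "U \<in> sets ?A"
    then have U[measurable]: "U \<in> sets borel" by simp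
    have "emeasure ?A U = (\<integral>\<^sup>+\<omega>. ennreal (indicator E \<omega>) * indicator (X -` U \<inter> space M) \<omega> \<partial>M)"
      by (simp add: emeasure_distr emeasure_density)
    also have "\<dots> = (\<integral>\<^sup>+\<omega>. indicator (X -` U \<inter> space M \<inter> E) \<omega> \<partial>M)"
      by (intro nn_integral_cong) (auto simp: indicator_def)
    also have "\<dots> = emeasure ?B U"
      by (simp add: emeasure_density_const emeasure_distr emeasure_eq_measure indep ennreal_mult mult.commute)
    finally show "emeasure ?A U = emeasure ?B U" .
  qed simp
  have "integrable M (\<lambda>\<omega>. indicator E \<omega> * X \<omega>) \<longleftrightarrow> integrable ?A (\<lambda>x. x)"
    by (simp add: integrable_distr_eq integrable_density)
  also have "\<dots> \<longleftrightarrow> integrable M (\<lambda>\<omega>. prob E * X \<omega>)"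
    unfolding eq by (subst integrable_density) (auto simp: integrable_distr_eq)
  finally show "integrable M (\<lambda>\<omega>. indicator E \<omega> * X \<omega>) \<longleftrightarrow> integrable M (\<lambda>\<omega>. prob E * X \<omega>)" .
  have "(\<integral>\<omega>. indicator E \<omega> * X \<omega> \<partial>M) = (\<integral>x. x \<partial>?A)"
    by (simp add: integral_distr integral_density)
  also have "\<dots> = prob E * (\<integral>\<omega>. X \<omega> \<partial>M)"
    unfolding eq by (subst integral_density) (auto simp: integral_distr)
  finally show "(\<integral>\<omega>. indicator E \<omega> * X \<omega> \<partial>M) = prob E * (\<integral>\<omega>. X \<omega> \<partial>M)" .
qed

section \<open>Differentiation under the integral sign\<close>

text \<open>The difference quotients along one sequence already converge to \<open>D\<close>, and
  their bound survives in the limit. Asking for the bound along a sequence only makes the lemma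
  usable with bounds that hold almost surely for each single parameter.\<close>

lemma abs_derivative_le_of_sequence:
  fixes f :: "real \<Rightarrow> real"
  assumes "(f has_real_derivative D) (at x within A)"
    and "\<And>n. X n \<in> A - {x}" and "X \<longlonglongrightarrow> x"
    and "\<And>n. \<bar>f (X n) - f x\<bar> \<le> c * \<bar>X n - x\<bar>"
  shows "\<bar>D\<bar> \<le> c"
proof (rule tendsto_upperbound)
  show "(\<lambda>n. \<bar>(f (X n) - f x) / (X n - x)\<bar>) \<longlonglongrightarrow> \<bar>D\<bar>"
    using assms(1-3) unfolding has_field_derivative_iff tendsto_at_iff_sequentially
    by (intro tendsto_rabs) (auto simp: o_def)
  show "\<forall>\<^sub>F n in sequentially. \<bar>(f (X n) - f x) / (X n - x)\<bar> \<le> c"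
    using assms(2,4) by (intro always_eventually) (auto simp: abs_divide divide_simps)
qed simp

text \<open>Dominated convergence for the difference quotients, with the Lipschitz weight
  \<open>w\<close> as majorant. The measure is arbitrary, so the lemma serves both expectations and
  sums over tables.\<close>

lemma
  fixes f :: "real \<Rightarrow> 'a \<Rightarrow> real"
  assumes x: "x \<in> A" "x islimpt A"
    and f: "\<And>t. t \<in> A \<Longrightarrow> integrable M (f t)"
    and w: "integrable M w"
    and lip: "\<And>t. t \<in> A \<Longrightarrow> AE \<omega> in M. \<bar>f t \<omega> - f x \<omega>\<bar> \<le> w \<omega> * \<bar>t - x\<bar>"
    and D: "D \<in> borel_measurable M"
    and deriv: "AE \<omega> in M. ((\<lambda>t. f t \<omega>) has_real_derivative D \<omega>) (at x within A)"
  shows AE_abs_derivative_le: "AE \<omega> in M. \<bar>D \<omega>\<bar> \<le> w \<omega>"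
    and integrable_dominated_derivative: "integrable M D"
    and integral_has_derivative_dominated:
      "((\<lambda>t. \<integral>\<omega>. f t \<omega> \<partial>M) has_real_derivative (\<integral>\<omega>. D \<omega> \<partial>M)) (at x within A)"
proof -
  show le: "AE \<omega> in M. \<bar>D \<omega>\<bar> \<le> w \<omega>"
  proof -
    obtain X where X: "\<And>n. X n \<in> A - {x}" "X \<longlonglongrightarrow> x"
      using x(2) unfolding islimpt_sequential by blast
    \<comment> \<open>The exceptional null set in \<open>lip\<close> depends on \<open>t\<close>;
      along a sequence only countably many of them have to be discarded.\<close>
    have "AE \<omega> in M. \<forall>n. \<bar>f (X n) \<omega> - f x \<omega>\<bar> \<le> w \<omega> * \<bar>X n - x\<bar>"
      unfolding AE_all_countable using lip X(1) by auto
    with deriv show ?thesis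
      by eventually_elim (rule abs_derivative_le_of_sequence[OF _ X], auto)
  qed
  show "integrable M D"
    by (rule Bochner_Integration.integrable_bound[OF w D]) (use le in \<open>eventually_elim, auto\<close>)
  show "((\<lambda>t. \<integral>\<omega>. f t \<omega> \<partial>M) has_real_derivative (\<integral>\<omega>. D \<omega> \<partial>M)) (at x within A)"
    unfolding has_field_derivative_iff tendsto_at_iff_sequentially
  proof (intro allI impI)
    fix X assume X: "\<forall>n. X n \<in> A - {x}" "X \<longlonglongrightarrow> x"
    have "(\<lambda>n. \<integral>\<omega>. (f (X n) \<omega> - f x \<omega>) / (X n - x) \<partial>M) \<longlonglongrightarrow> (\<integral>\<omega>. D \<omega> \<partial>M)"
    proof (rule integral_dominated_convergence[OF D _ w])
      show "(\<lambda>\<omega>. (f (X n) \<omega> - f x \<omega>) / (X n - x)) \<in> borel_measurable M" for n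
        using f[of "X n"] f[of x] X(1) x(1) by auto
      show "AE \<omega> in M. (\<lambda>n. (f (X n) \<omega> - f x \<omega>) / (X n - x)) \<longlonglongrightarrow> D \<omega>"
        using deriv
      proof eventually_elim
        case (elim \<omega>)
        then show ?case
          using X unfolding has_field_derivative_iff tendsto_at_iff_sequentially by (auto simp: o_def)
      qed
      fix n
      have "X n \<noteq> x" "X n \<in> A"
        using X(1) by auto
      with lip[of "X n"] show "AE \<omega> in M. norm ((f (X n) \<omega> - f x \<omega>) / (X n - x)) \<le> w \<omega>"
        by (auto simp: abs_divide divide_simps elim: eventually_mono)
    qed
    moreover have "(\<integral>\<omega>. (f (X n) \<omega> - f x \<omega>) / (X n - x) \<partial>M)
        = ((\<integral>\<omega>. f (X n) \<omega> \<partial>M) - (\<integral>\<omega>. f x \<omega> \<partial>M)) / (X n - x)" for n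
      using f[of "X n"] f[of x] X(1) x(1) by simp
    ultimately show "((\<lambda>t. ((\<integral>\<omega>. f t \<omega> \<partial>M) - (\<integral>\<omega>. f x \<omega> \<partial>M)) / (t - x)) \<circ> X)
        \<longlonglongrightarrow> (\<integral>\<omega>. D \<omega> \<partial>M)"
      by (simp only: o_def)
  qed
qed

section \<open>Completed measures and independence\<close>

text \<open>As the law of \<open>X\<close> is \<open>N\<close> itself, \<open>X\<close> pulls null
  sets of \<open>N\<close> back to null sets of \<open>M\<close>, so it stays measurable between the
  completions. This transports expectations with respect to the completed measure to the sample
  space of the realizations.\<close>

lemma distr_completion_completion:
  assumes "X \<in> M \<rightarrow>\<^sub>M N" and "distr M N X = N"
  shows "X \<in> completion M \<rightarrow>\<^sub>M completion N" and "distr (completion M) (completion N) X = completion N"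
proof -
  have 1: "X \<in> completion M \<rightarrow>\<^sub>M N" "distr (completion M) N X = N"
    using assms by (simp_all add: measurable_completion distr_completion)
  show "X \<in> completion M \<rightarrow>\<^sub>M completion N"
    using 1 by (intro completion.measurable_completion2) auto
  show "distr (completion M) (completion N) X = completion N"
    using completion.completion_distr_eq[OF 1(1)] 1(2) by simp
qed

text \<open>Applied with \<open>V\<close> a single table: the expectation over that routing event
  factors, and if the event has positive probability, integrability on the event already gives
  integrability of \<open>X\<close>.\<close>

lemma
  fixes X :: "'a \<Rightarrow> real"
  assumes M: "prob_space M" and indep: "indep_rv M borel X B Y" and V: "V \<in> sets B"
  defines "E \<equiv> Y -` V \<inter> space M"
  shows indep_rv_integrable_iff:
      "integrable M (\<lambda>\<omega>. indicator E \<omega> * X \<omega>) \<longleftrightarrow> integrable M (\<lambda>\<omega>. measure M E * X \<omega>)"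
    and indep_rv_integral:
      "(\<integral>\<omega>. indicator E \<omega> * X \<omega> \<partial>M) = measure M E * (\<integral>\<omega>. X \<omega> \<partial>M)"
    and indep_rv_integral_abs:
      "(\<integral>\<omega>. indicator E \<omega> * \<bar>X \<omega>\<bar> \<partial>M) = measure M E * (\<integral>\<omega>. \<bar>X \<omega>\<bar> \<partial>M)"
proof -
  interpret prob_space M by (rule M)
  have X[measurable]: "X \<in> borel_measurable M" and Y: "Y \<in> M \<rightarrow>\<^sub>M B"
    and ind: "indep_set {X -` U \<inter> space M |U. U \<in> sets borel} {Y -` V \<inter> space M |V. V \<in> sets B}"
    using indep unfolding indep_rv_def by auto
  have E: "E \<in> events"
    unfolding E_def by (rule measurable_sets[OF Y V])
  have *: "prob (X -` U \<inter> space M \<inter> E) = prob (X -` U \<inter> space M) * prob E" if "U \<in> sets borel" for U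
    using that V unfolding E_def by (intro indep_setD[OF ind]) auto
  show "integrable M (\<lambda>\<omega>. indicator E \<omega> * X \<omega>) \<longleftrightarrow> integrable M (\<lambda>\<omega>. prob E * X \<omega>)"
    "(\<integral>\<omega>. indicator E \<omega> * X \<omega> \<partial>M) = prob E * (\<integral>\<omega>. X \<omega> \<partial>M)"
    using * by (intro integrable_indep_event_iff integral_indep_event X E; simp)+
  have "prob ((\<lambda>\<omega>. \<bar>X \<omega>\<bar>) -` U \<inter> space M \<inter> E) = prob ((\<lambda>\<omega>. \<bar>X \<omega>\<bar>) -` U \<inter> space M) * prob E"
    if U: "U \<in> sets borel" for U
  proof -
    \<comment> \<open>The map \<open>abs\<close> is Borel, so an event about the absolute value of
      \<open>X\<close> is an event about \<open>X\<close> and inherits the product rule.\<close>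
    have "(abs :: real \<Rightarrow> real) -` U \<inter> space borel \<in> sets borel"
      using U by (intro measurable_sets[of abs borel borel]) auto
    then show ?thesis
      using *[of "abs -` U"] by (simp add: vimage_def)
  qed
  then show "(\<integral>\<omega>. indicator E \<omega> * \<bar>X \<omega>\<bar> \<partial>M) = prob E * (\<integral>\<omega>. \<bar>X \<omega>\<bar> \<partial>M)"
    by (intro integral_indep_event E) auto
qed

section \<open>Termwise differentiation of a series of products\<close>

lemma islimpt_Int_ball:
  fixes x :: "'a::metric_space"
  assumes "x islimpt A" and "\<delta> > 0"
  shows "x islimpt A \<inter> ball x \<delta>"
proof -
  have "at x within A \<inter> ball x \<delta> = at x within A"
    using assms(2) by (intro at_within_nhd[of _ "ball x \<delta>"]) auto
  then show ?thesis
    using assms(1) by (metis trivial_limit_within)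
qed

text \<open>For finite \<open>I\<close> these are the sum and product rules. For infinite
  \<open>I\<close> the series is an integral over \<open>count_space I\<close>, to which
  differentiation under the integral applies with a majorant built from \<open>b\<close>.\<close>

lemma product_series_has_derivative:
  fixes p f :: "real \<Rightarrow> 'i \<Rightarrow> real"
  assumes x: "x \<in> A" "x islimpt A"
    and int: "\<And>t. t \<in> A \<Longrightarrow> integrable (count_space I) (\<lambda>i. p t i * f t i)"
    and p: "\<And>i. i \<in> I \<Longrightarrow> ((\<lambda>t. p t i) has_real_derivative p' i) (at x within A)"
    and f: "\<And>i. i \<in> I \<Longrightarrow> ((\<lambda>t. f t i) has_real_derivative f' i) (at x within A)"
    and nonneg: "\<And>t i. t \<in> A \<Longrightarrow> i \<in> I \<Longrightarrow> 0 \<le> p t i"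
    and lip: "\<And>t i. t \<in> A \<Longrightarrow> i \<in> I \<Longrightarrow> \<bar>f t i - f x i\<bar> \<le> L i * \<bar>t - x\<bar>"
    and dom: "infinite I \<Longrightarrow> \<exists>b \<delta>. \<delta> > 0 \<and> integrable (count_space I) b \<and>
        (\<forall>i\<in>I. \<forall>t\<in>A. \<bar>t - x\<bar> < \<delta> \<longrightarrow>
          p t i * L i \<le> b i \<and> \<bar>p t i - p x i\<bar> * \<bar>f x i\<bar> \<le> b i * \<bar>t - x\<bar>)"
  shows "((\<lambda>t. \<integral>i. p t i * f t i \<partial>count_space I) has_real_derivative
      (\<integral>i. p x i * f' i + p' i * f x i \<partial>count_space I)) (at x within A)"
proof -
  have deriv: "((\<lambda>t. p t i * f t i) has_real_derivative p x i * f' i + p' i * f x i) (at x within A)"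
    if "i \<in> I" for i
    using p[OF that] f[OF that] by (auto intro!: derivative_eq_intros simp: algebra_simps)
  show ?thesis
  proof (cases "finite I")
    case True
    then show ?thesis
      using deriv by (simp add: lebesgue_integral_count_space_finite DERIV_sum)
  next
    case False
    then obtain b \<delta> where \<delta>: "\<delta> > 0" and b: "integrable (count_space I) b"
      and dom1: "\<And>i t. i \<in> I \<Longrightarrow> t \<in> A \<Longrightarrow> \<bar>t - x\<bar> < \<delta> \<Longrightarrow> p t i * L i \<le> b i"
      and dom2: "\<And>i t. i \<in> I \<Longrightarrow> t \<in> A \<Longrightarrow> \<bar>t - x\<bar> < \<delta> \<Longrightarrow>
          \<bar>p t i - p x i\<bar> * \<bar>f x i\<bar> \<le> b i * \<bar>t - x\<bar>"
      using dom by blast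
    let ?B = "A \<inter> ball x \<delta>"
    \<comment> \<open>The function \<open>b\<close> majorizes only within distance
      \<open>\<delta>\<close> of \<open>x\<close>; cutting \<open>A\<close> down to a ball leaves
      derivatives at \<open>x\<close> unchanged.\<close>
    have within: "at x within ?B = at x within A"
      using \<delta> by (intro at_within_nhd[of _ "ball x \<delta>"]) auto
    have "((\<lambda>t. \<integral>i. p t i * f t i \<partial>count_space I) has_real_derivative
        (\<integral>i. p x i * f' i + p' i * f x i \<partial>count_space I)) (at x within ?B)"
    proof (rule integral_has_derivative_dominated)
      show "x \<in> ?B" using x(1) \<delta> by simp
      show "x islimpt ?B" using x(2) \<delta> by (rule islimpt_Int_ball)
      \<comment> \<open>One \<open>b i\<close> pays for the increment of \<open>f\<close>, the other
        for the increment of \<open>p\<close>.\<close>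
      show "integrable (count_space I) (\<lambda>i. 2 * b i)" using b by simp
      show "AE i in count_space I.
          ((\<lambda>t. p t i * f t i) has_real_derivative p x i * f' i + p' i * f x i) (at x within ?B)"
        unfolding within using deriv by (simp add: AE_count_space)
      fix t assume t: "t \<in> ?B"
      then show "integrable (count_space I) (\<lambda>i. p t i * f t i)" using int by simp
      have "\<bar>p t i * f t i - p x i * f x i\<bar> \<le> 2 * b i * \<bar>t - x\<bar>" if i: "i \<in> I" for i
      proof -
        have t': "t \<in> A" "\<bar>t - x\<bar> < \<delta>" using t by (auto simp: dist_real_def)
        \<comment> \<open>The increment is split so that the increment of \<open>f\<close> carries
          the weight \<open>p t i\<close> and that of \<open>p\<close> the weight
          \<open>f x i\<close>, as in \<open>dom1\<close> and \<open>dom2\<close>.\<close>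
        have "\<bar>p t i * f t i - p x i * f x i\<bar> = \<bar>p t i * (f t i - f x i) + (p t i - p x i) * f x i\<bar>"
          by (simp add: algebra_simps)
        also have "\<dots> \<le> p t i * \<bar>f t i - f x i\<bar> + \<bar>p t i - p x i\<bar> * \<bar>f x i\<bar>"
          using nonneg[OF t'(1) i] by (metis abs_mult abs_of_nonneg abs_triangle_ineq)
        also have "p t i * \<bar>f t i - f x i\<bar> \<le> p t i * (L i * \<bar>t - x\<bar>)"
          using lip[OF t'(1) i] nonneg[OF t'(1) i] by (rule mult_left_mono)
        also have "\<dots> \<le> b i * \<bar>t - x\<bar>"
          using mult_right_mono[OF dom1[OF i t'], of "\<bar>t - x\<bar>"] by (simp add: mult.assoc)
        also have "\<bar>p t i - p x i\<bar> * \<bar>f x i\<bar> \<le> b i * \<bar>t - x\<bar>"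
          by (rule dom2[OF i t'])
        finally show ?thesis by simp
      qed
      then show "AE i in count_space I. \<bar>p t i * f t i - p x i * f x i\<bar> \<le> 2 * b i * \<bar>t - x\<bar>"
        by (simp add: AE_count_space)
    qed simp
    then show ?thesis unfolding within .
  qed
qed

text \<open>Unordered summability of real terms is automatically absolute, and absolute summability
  is integrability for the counting measure.\<close>

lemma summable_on_iff_integrable_count_space:
  fixes f :: "'i \<Rightarrow> real"
  shows "f summable_on I \<longleftrightarrow> integrable (count_space I) f"
  using summable_on_iff_abs_summable_on_real[of f I] abs_summable_equivalent[of f I]
  by (simp add: Infinite_Set_Sum.abs_summable_on_def)

theorem theorem2:
  fixes P :: "'w measure"
    and S :: "'s measure"
    and N m :: nat
    and \<Theta> :: "real set"
    and Rt :: "real \<Rightarrow> 'w \<Rightarrow> table"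
    and F :: "real \<Rightarrow> 'w \<Rightarrow> table \<Rightarrow> real"
    and lam :: "table \<Rightarrow> 'w \<Rightarrow> real"
    and X :: "nat \<Rightarrow> 's \<Rightarrow> 'w"
    and \<theta>0 :: real
  defines "\<R> \<equiv> possible_tables P \<Theta> Rt"
  assumes P: "prob_space P"
    and N: "0 < N"
    and \<Theta>: "\<And>\<theta>. \<theta> \<in> \<Theta> \<Longrightarrow> \<theta> islimpt \<Theta>"
    and Rt_meas: "\<And>\<theta>. \<theta> \<in> \<Theta> \<Longrightarrow> Rt \<theta> \<in> P \<rightarrow>\<^sub>M table_space N"
    and F_meas: "\<And>\<theta> R. \<theta> \<in> \<Theta> \<Longrightarrow> R \<in> \<R> \<Longrightarrow> (\<lambda>\<omega>. F \<theta> \<omega> R) \<in> borel_measurable P"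
    and F_int: "\<And>\<theta>. \<theta> \<in> \<Theta> \<Longrightarrow> integrable P (\<lambda>\<omega>. F \<theta> \<omega> (Rt \<theta> \<omega>))"
    and F_repr: "\<And>\<theta> \<omega>. \<theta> \<in> \<Theta> \<Longrightarrow> \<omega> \<in> space P \<Longrightarrow>
        F \<theta> \<omega> (Rt \<theta> \<omega>) =
        (\<Sum>\<^sub>\<infinity>R\<in>\<R>. indicat_real {\<omega>' \<in> space P. Rt \<theta> \<omega>' = R} \<omega> * F \<theta> \<omega> R)"
    and i_diff: "\<And>\<theta> R. \<theta> \<in> \<Theta> \<Longrightarrow> R \<in> \<R> \<Longrightarrow>
        AE \<omega> in P. (\<lambda>t. F t \<omega> R) differentiable (at \<theta> within \<Theta>)"
    and i_lam: "\<And>R. R \<in> \<R> \<Longrightarrow> integrable P (lam R)"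
    and i_lipschitz: "\<And>\<theta>1 \<theta>2 R. \<theta>1 \<in> \<Theta> \<Longrightarrow> \<theta>2 \<in> \<Theta> \<Longrightarrow> R \<in> \<R> \<Longrightarrow>
        AE \<omega> in P. \<bar>F \<theta>1 \<omega> R - F \<theta>2 \<omega> R\<bar> \<le> lam R \<omega> * \<bar>\<theta>1 - \<theta>2\<bar>"
    and ii_indep: "\<And>\<theta> R. \<theta> \<in> \<Theta> \<Longrightarrow> R \<in> \<R> \<Longrightarrow>
        indep_rv P borel (\<lambda>\<omega>. F \<theta> \<omega> R) (table_space N) (Rt \<theta>)"
    and ii_indep_deriv: "\<And>R. R \<in> \<R> \<Longrightarrow>
        indep_rv (completion P)
          borel (\<lambda>\<omega>. vector_derivative (\<lambda>t. F t \<omega> R) (at \<theta>0 within \<Theta>))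
          (table_space N) (Rt \<theta>0)"
    and iii_diff: "\<And>\<theta> R. \<theta> \<in> \<Theta> \<Longrightarrow> R \<in> \<R> \<Longrightarrow>
        (\<lambda>t. table_prob P Rt t R) differentiable (at \<theta> within \<Theta>)"
    and iii_cont: "\<And>R. R \<in> \<R> \<Longrightarrow>
        continuous_on \<Theta> (\<lambda>\<theta>. vector_derivative (\<lambda>t. table_prob P Rt t R) (at \<theta> within \<Theta>))"
    and iii_pos: "\<And>\<theta> R. \<theta> \<in> \<Theta> \<Longrightarrow> R \<in> \<R> \<Longrightarrow> 0 < table_prob P Rt \<theta> R"
    and \<theta>0: "\<theta>0 \<in> \<Theta>"
    and dominated: "infinite \<R> \<Longrightarrow> terms_dominated P \<Theta> F Rt lam \<theta>0"
    and m: "0 < m"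
    and S: "prob_space S"
    and X_indep: "prob_space.indep_vars S (\<lambda>_. P) X {1..m}"
    and X_law: "\<And>i. i \<in> {1..m} \<Longrightarrow> distr S P (X i) = P"
  shows "integrable (completion S) (\<lambda>s. grad_estimate P \<Theta> F Rt \<theta>0 m (\<lambda>i. X i s)) \<and>
    ((\<lambda>\<theta>. \<integral>\<omega>. F \<theta> \<omega> (Rt \<theta> \<omega>) \<partial>P) has_real_derivative
      (\<integral>s. grad_estimate P \<Theta> F Rt \<theta>0 m (\<lambda>i. X i s) \<partial>completion S)) (at \<theta>0 within \<Theta>)"
proof -
  interpret P: prob_space P by (rule P)
  interpret C: prob_space "completion P" by (rule P.prob_space_completion)
  interpret S: prob_space S by (rule S)
  define E where "E \<theta> R = Rt \<theta> -` {R} \<inter> space P" for \<theta> R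
  define p where "p \<theta> R = table_prob P Rt \<theta> R" for \<theta> R
  define f where "f \<theta> R = (\<integral>\<omega>. F \<theta> \<omega> R \<partial>P)" for \<theta> R
  define D where "D R \<omega> = vector_derivative (\<lambda>t. F t \<omega> R) (at \<theta>0 within \<Theta>)" for R \<omega>
  define p' where "p' R = vector_derivative (\<lambda>t. p t R) (at \<theta>0 within \<Theta>)" for R
  define d where "d R = (\<integral>\<omega>. D R \<omega> \<partial>completion P)" for R
  define L where "L R = (\<integral>\<omega>. lam R \<omega> \<partial>P)" for R
  define s where "s R = score P \<Theta> Rt \<theta>0 R" for R

  \<comment> \<open>Countability of the set of tables and measurability of the routing
    events\<close>
  have limpt: "\<theta>0 islimpt \<Theta>" by (rule \<Theta>[OF \<theta>0])
  then have nontriv: "at \<theta>0 within \<Theta> \<noteq> bot" by (simp add: trivial_limit_within)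
  have p_eq: "p \<theta> R = measure P (E \<theta> R)" for \<theta> R
    unfolding p_def table_prob_def E_def by (rule arg_cong[where f = "measure P"]) auto
  have p_pos: "0 < p \<theta> R" if "\<theta> \<in> \<Theta>" "R \<in> \<R>" for \<theta> R
    unfolding p_def by (rule iii_pos[OF that])

  have \<R>_space: "{R} \<in> sets (table_space N)" if "R \<in> \<R>" for R
    using that measurable_space[OF Rt_meas] unfolding \<R>_def possible_tables_def
    by (auto intro!: singleton_in_sets_table_space)
  have E_sets: "E \<theta> R \<in> sets P" if "\<theta> \<in> \<Theta>" "R \<in> \<R>" for \<theta> R
    unfolding E_def by (rule measurable_sets[OF Rt_meas[OF that(1)] \<R>_space[OF that(2)]])
  have \<R>_countable: "countable \<R>"
  proof -
    \<comment> \<open>A probability law has at most countably many atoms, and by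
      \<open>iii_pos\<close> every table in \<R> is an atom of the law of the table at
      \<open>\<theta>0\<close>.\<close>
    interpret T: prob_space "distr P (table_space N) (Rt \<theta>0)"
      by (rule P.prob_space_distr[OF Rt_meas[OF \<theta>0]])
    have "measure (distr P (table_space N) (Rt \<theta>0)) {R} \<noteq> 0" if "R \<in> \<R>" for R
      using p_pos[OF \<theta>0 that] unfolding p_eq E_def
      by (simp add: measure_distr[OF Rt_meas[OF \<theta>0] \<R>_space[OF that]])
    then show ?thesis
      by (intro countable_subset[OF _ T.countable_support]) auto
  qed
  have Rt_count: "Rt \<theta> \<in> P \<rightarrow>\<^sub>M count_space \<R>" if "\<theta> \<in> \<Theta>" for \<theta>
    using that E_sets unfolding measurable_count_space_eq_countable[OF \<R>_countable]
    by (auto simp: E_def \<R>_def possible_tables_def)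

  \<comment> \<open>The expected performance as a series over tables\<close>
  have F_integrable: "integrable P (\<lambda>\<omega>. F \<theta> \<omega> R)"
    and F_E: "(\<integral>\<omega>. indicator (E \<theta> R) \<omega> * F \<theta> \<omega> R \<partial>P) = p \<theta> R * f \<theta> R"
    and F_E_abs: "(\<integral>\<omega>. indicator (E \<theta> R) \<omega> * \<bar>F \<theta> \<omega> R\<bar> \<partial>P) = p \<theta> R * (\<integral>\<omega>. \<bar>F \<theta> \<omega> R\<bar> \<partial>P)"
    if \<theta>: "\<theta> \<in> \<Theta>" and R: "R \<in> \<R>" for \<theta> R
  proof -
    note ind = P ii_indep[OF \<theta> R] \<R>_space[OF R]
    \<comment> \<open>Integrability for a fixed table is extracted from \<open>F_int\<close>: the
      part on \<open>E \<theta> R\<close> is integrable, independence trades the indicator for the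
      factor \<open>p \<theta> R\<close>, and this factor is positive.\<close>
    have "integrable P (\<lambda>\<omega>. indicator (E \<theta> R) \<omega> * F \<theta> \<omega> R)"
      unfolding E_def
      by (rule integrable_partition_term[OF P.sigma_finite_measure_axioms \<R>_countable Rt_count[OF \<theta>],
            where g = "\<lambda>R \<omega>. F \<theta> \<omega> R"])
        (use F_meas F_int \<theta> R in auto)
    then show "integrable P (\<lambda>\<omega>. F \<theta> \<omega> R)"
      using indep_rv_integrable_iff[OF ind] p_pos[OF \<theta> R] by (simp add: p_eq E_def)
    show "(\<integral>\<omega>. indicator (E \<theta> R) \<omega> * F \<theta> \<omega> R \<partial>P) = p \<theta> R * f \<theta> R"
      using indep_rv_integral[OF ind] by (simp add: p_eq f_def E_def)
    show "(\<integral>\<omega>. indicator (E \<theta> R) \<omega> * \<bar>F \<theta> \<omega> R\<bar> \<partial>P) = p \<theta> R * (\<integral>\<omega>. \<bar>F \<theta> \<omega> R\<bar> \<partial>P)"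
      using indep_rv_integral_abs[OF ind] by (simp add: p_eq E_def)
  qed

  have mean_sum: "integrable (count_space \<R>) (\<lambda>R. p \<theta> R * f \<theta> R)"
      "(\<integral>\<omega>. F \<theta> \<omega> (Rt \<theta> \<omega>) \<partial>P) = (\<integral>R. p \<theta> R * f \<theta> R \<partial>count_space \<R>)"
    if \<theta>: "\<theta> \<in> \<Theta>" for \<theta>
  proof -
    note part = P.sigma_finite_measure_axioms \<R>_countable Rt_count[OF \<theta>] F_meas[OF \<theta>] F_int[OF \<theta>]
    have "integrable (count_space \<R>) (\<lambda>R. \<integral>\<omega>. indicator (E \<theta> R) \<omega> * F \<theta> \<omega> R \<partial>P)"
      unfolding E_def by (rule integrable_partition_integrals[where g = "\<lambda>R \<omega>. F \<theta> \<omega> R", OF part])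
    then show "integrable (count_space \<R>) (\<lambda>R. p \<theta> R * f \<theta> R)"
      by (rule Bochner_Integration.integrable_cong[THEN iffD1, rotated 2]) (simp_all add: F_E \<theta>)
    have "(\<integral>\<omega>. F \<theta> \<omega> (Rt \<theta> \<omega>) \<partial>P)
        = (\<integral>R. (\<integral>\<omega>. indicator (E \<theta> R) \<omega> * F \<theta> \<omega> R \<partial>P) \<partial>count_space \<R>)"
      unfolding E_def by (rule integral_partition[where g = "\<lambda>R \<omega>. F \<theta> \<omega> R", OF part])
    also have "\<dots> = (\<integral>R. p \<theta> R * f \<theta> R \<partial>count_space \<R>)"
      by (rule Bochner_Integration.integral_cong) (simp_all add: F_E \<theta>)
    finally show "(\<integral>\<omega>. F \<theta> \<omega> (Rt \<theta> \<omega>) \<partial>P) = (\<integral>R. p \<theta> R * f \<theta> R \<partial>count_space \<R>)" .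
  qed

  \<comment> \<open>Differentiating the mean for a fixed table\<close>
  have D_integrable: "integrable (completion P) (D R)"
    and f_deriv: "((\<lambda>t. f t R) has_real_derivative d R) (at \<theta>0 within \<Theta>)"
    and D_abs: "(\<integral>\<omega>. \<bar>D R \<omega>\<bar> \<partial>completion P) \<le> L R"
    and D_E: "(\<integral>\<omega>. indicator (E \<theta>0 R) \<omega> * D R \<omega> \<partial>completion P) = p \<theta>0 R * d R"
    and D_E_abs: "(\<integral>\<omega>. indicator (E \<theta>0 R) \<omega> * \<bar>D R \<omega>\<bar> \<partial>completion P)
        = p \<theta>0 R * (\<integral>\<omega>. \<bar>D R \<omega>\<bar> \<partial>completion P)"
    if R: "R \<in> \<R>" for R
  proof -
    have ind: "indep_rv (completion P) borel (D R) (table_space N) (Rt \<theta>0)"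
      using ii_indep_deriv[OF R] by (simp add: D_def[abs_def])
    have D_meas: "D R \<in> borel_measurable (completion P)"
      using ind by (simp add: indep_rv_def)
    \<comment> \<open>Measurability of \<open>D R\<close> is given for \<open>completion P\<close>,
      so the other data are moved there before differentiating.\<close>
    have F_C: "integrable (completion P) (\<lambda>\<omega>. F t \<omega> R)" if "t \<in> \<Theta>" for t
      using F_integrable[OF that R] F_meas[OF that R] by (simp add: integrable_completion)
    have lam_C: "integrable (completion P) (lam R)"
      using i_lam[OF R] by (simp add: integrable_completion)
    have lip_C: "AE \<omega> in completion P. \<bar>F t \<omega> R - F \<theta>0 \<omega> R\<bar> \<le> lam R \<omega> * \<bar>t - \<theta>0\<bar>"
      if "t \<in> \<Theta>" for t
      by (rule AE_completion[OF i_lipschitz[OF that \<theta>0 R]])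
    have "AE \<omega> in completion P. (\<lambda>t. F t \<omega> R) differentiable (at \<theta>0 within \<Theta>)"
      by (rule AE_completion[OF i_diff[OF \<theta>0 R]])
    then have deriv: "AE \<omega> in completion P. ((\<lambda>t. F t \<omega> R) has_real_derivative D R \<omega>) (at \<theta>0 within \<Theta>)"
      by eventually_elim
        (simp add: D_def has_real_derivative_iff_has_vector_derivative vector_derivative_works)
    note dom = \<theta>0 limpt F_C lam_C lip_C D_meas deriv
    show D_int: "integrable (completion P) (D R)"
      by (rule integrable_dominated_derivative[OF dom])
    have "((\<lambda>t. \<integral>\<omega>. F t \<omega> R \<partial>completion P) has_real_derivative d R) (at \<theta>0 within \<Theta>)"
      unfolding d_def by (rule integral_has_derivative_dominated[OF dom])
    \<comment> \<open>For fixed \<open>t\<close> in \<Theta> the integrand is measurable for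
      \<open>P\<close>, so its integrals over \<open>P\<close> and over the completion
      agree.\<close>
    then show "((\<lambda>t. f t R) has_real_derivative d R) (at \<theta>0 within \<Theta>)"
      by (rule has_field_derivative_transform_within[OF _ zero_less_one \<theta>0])
        (simp add: f_def integral_completion F_meas R)
    have "(\<integral>\<omega>. \<bar>D R \<omega>\<bar> \<partial>completion P) \<le> (\<integral>\<omega>. lam R \<omega> \<partial>completion P)"
      using D_int lam_C AE_abs_derivative_le[OF dom] by (intro integral_mono_AE) auto
    then show "(\<integral>\<omega>. \<bar>D R \<omega>\<bar> \<partial>completion P) \<le> L R"
      using i_lam[OF R] by (simp add: L_def integral_completion)
    have p_C: "measure (completion P) (E \<theta>0 R) = p \<theta>0 R"
      by (simp add: p_eq E_sets \<theta>0 R)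
    show "(\<integral>\<omega>. indicator (E \<theta>0 R) \<omega> * D R \<omega> \<partial>completion P) = p \<theta>0 R * d R"
      using indep_rv_integral[OF C.prob_space_axioms ind \<R>_space[OF R]] p_C by (simp add: d_def E_def)
    show "(\<integral>\<omega>. indicator (E \<theta>0 R) \<omega> * \<bar>D R \<omega>\<bar> \<partial>completion P)
        = p \<theta>0 R * (\<integral>\<omega>. \<bar>D R \<omega>\<bar> \<partial>completion P)"
      using indep_rv_integral_abs[OF C.prob_space_axioms ind \<R>_space[OF R]] p_C by (simp add: E_def)
  qed

  \<comment> \<open>Integration turns the almost sure bound into a sure Lipschitz bound for the
    means, with the mean of \<open>lam R\<close> as constant.\<close>
  have f_lip: "\<bar>f t R - f \<theta>0 R\<bar> \<le> L R * \<bar>t - \<theta>0\<bar>" if t: "t \<in> \<Theta>" and R: "R \<in> \<R>" for t R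
  proof -
    have "\<bar>f t R - f \<theta>0 R\<bar> = \<bar>\<integral>\<omega>. F t \<omega> R - F \<theta>0 \<omega> R \<partial>P\<bar>"
      using F_integrable[OF t R] F_integrable[OF \<theta>0 R] by (simp add: f_def)
    also have "\<dots> \<le> (\<integral>\<omega>. \<bar>F t \<omega> R - F \<theta>0 \<omega> R\<bar> \<partial>P)"
      by (rule integral_abs_bound)
    also have "\<dots> \<le> (\<integral>\<omega>. lam R \<omega> * \<bar>t - \<theta>0\<bar> \<partial>P)"
      using F_integrable[OF t R] F_integrable[OF \<theta>0 R] i_lam[OF R] i_lipschitz[OF t \<theta>0 R]
      by (intro integral_mono_AE) auto
    finally show ?thesis by (simp add: L_def)
  qed
  have p_deriv: "((\<lambda>t. p t R) has_real_derivative p' R) (at \<theta>0 within \<Theta>)" if "R \<in> \<R>" for R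
    using iii_diff[OF \<theta>0 that] unfolding p_def p'_def
    by (simp add: has_real_derivative_iff_has_vector_derivative vector_derivative_works)
  have s_eq: "s R = p' R / p \<theta>0 R" if R: "R \<in> \<R>" for R
  proof -
    \<comment> \<open>Positivity makes the chain rule for \<open>ln\<close> applicable. Since
      \<open>\<theta>0\<close> is a limit point of \<Theta>, the derivative within \<Theta> is
      unique, which identifies \<open>score\<close> with this value.\<close>
    have "((\<lambda>t. ln (p t R)) has_real_derivative p' R / p \<theta>0 R) (at \<theta>0 within \<Theta>)"
      using p_deriv[OF R] p_pos[OF \<theta>0 R] by (auto intro!: derivative_eq_intros simp: field_simps)
    then show ?thesis
      unfolding s_def score_def p_def[symmetric] has_real_derivative_iff_has_vector_derivative
      by (rule vector_derivative_within[OF nontriv])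
  qed

  have domE: "\<exists>b \<delta>. \<delta> > 0 \<and> integrable (count_space \<R>) b \<and>
      (\<forall>R\<in>\<R>. \<forall>t\<in>\<Theta>. \<bar>t - \<theta>0\<bar> < \<delta> \<longrightarrow> p t R * L R \<le> b R \<and>
        \<bar>p t R - p \<theta>0 R\<bar> * (\<integral>\<omega>. \<bar>F \<theta>0 \<omega> R\<bar> \<partial>P) \<le> b R * \<bar>t - \<theta>0\<bar>)" if "infinite \<R>"
    using dominated[OF that]
    by (simp add: terms_dominated_def summable_on_iff_integrable_count_space
        p_def[symmetric] L_def[symmetric] \<R>_def[symmetric])

  \<comment> \<open>Derivative of the expected performance\<close>
  have deriv: "((\<lambda>\<theta>. \<integral>\<omega>. F \<theta> \<omega> (Rt \<theta> \<omega>) \<partial>P) has_real_derivative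
      (\<integral>R. p \<theta>0 R * d R + p' R * f \<theta>0 R \<partial>count_space \<R>)) (at \<theta>0 within \<Theta>)"
  proof (rule has_field_derivative_transform_within[OF _ zero_less_one \<theta>0])
    show "((\<lambda>t. \<integral>R. p t R * f t R \<partial>count_space \<R>) has_real_derivative
        (\<integral>R. p \<theta>0 R * d R + p' R * f \<theta>0 R \<partial>count_space \<R>)) (at \<theta>0 within \<Theta>)"
    proof (rule product_series_has_derivative[OF \<theta>0 limpt mean_sum(1) p_deriv f_deriv _ f_lip])
      show "0 \<le> p t R" if "t \<in> \<Theta>" "R \<in> \<R>" for t R
        using p_pos[OF that] by simp
      assume "infinite \<R>"
      from domE[OF this] obtain b \<delta> where *: "\<delta> > 0" "integrable (count_space \<R>) b"
        "\<And>R t. R \<in> \<R> \<Longrightarrow> t \<in> \<Theta> \<Longrightarrow> \<bar>t - \<theta>0\<bar> < \<delta> \<Longrightarrow> p t R * L R \<le> b R"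
        "\<And>R t. R \<in> \<R> \<Longrightarrow> t \<in> \<Theta> \<Longrightarrow> \<bar>t - \<theta>0\<bar> < \<delta> \<Longrightarrow>
          \<bar>p t R - p \<theta>0 R\<bar> * (\<integral>\<omega>. \<bar>F \<theta>0 \<omega> R\<bar> \<partial>P) \<le> b R * \<bar>t - \<theta>0\<bar>"
        by blast
      \<comment> \<open>The domination hypothesis controls the mean of the absolute value of
        \<open>F\<close>; the series lemma asks for the absolute value of the mean, which is no
        larger.\<close>
      have "\<bar>p t R - p \<theta>0 R\<bar> * \<bar>f \<theta>0 R\<bar> \<le> b R * \<bar>t - \<theta>0\<bar>"
        if "R \<in> \<R>" "t \<in> \<Theta>" "\<bar>t - \<theta>0\<bar> < \<delta>" for R t
        using mult_left_mono[OF integral_abs_bound[of P "\<lambda>\<omega>. F \<theta>0 \<omega> R"], of "\<bar>p t R - p \<theta>0 R\<bar>"]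
          *(4)[OF that] by (simp add: f_def)
      then show "\<exists>b \<delta>. \<delta> > 0 \<and> integrable (count_space \<R>) b \<and>
        (\<forall>R\<in>\<R>. \<forall>t\<in>\<Theta>. \<bar>t - \<theta>0\<bar> < \<delta> \<longrightarrow>
          p t R * L R \<le> b R \<and> \<bar>p t R - p \<theta>0 R\<bar> * \<bar>f \<theta>0 R\<bar> \<le> b R * \<bar>t - \<theta>0\<bar>)"
        using * by blast
    qed
  qed (simp add: mean_sum(2))

  \<comment> \<open>Integrability and mean of one gradient sample\<close>
  \<comment> \<open>The gradient sample with the table frozen at \<open>R\<close>; on
    \<open>E \<theta>0 R\<close> it coincides with the sample itself.\<close>
  let ?g = "\<lambda>R \<omega>. D R \<omega> + F \<theta>0 \<omega> R * s R"
  have F_C: "integrable (completion P) (\<lambda>\<omega>. F \<theta>0 \<omega> R)" if "R \<in> \<R>" for R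
    using F_integrable[OF \<theta>0 that] F_meas[OF \<theta>0 that] by (simp add: integrable_completion)
  have E_C: "E \<theta>0 R \<in> sets (completion P)" if "R \<in> \<R>" for R
    using E_sets[OF \<theta>0 that] by simp
  have restrict: "integrable (completion P) (\<lambda>\<omega>. indicator (E \<theta>0 R) \<omega> * h \<omega>)"
    if "integrable (completion P) h" "R \<in> \<R>" for h :: "'w \<Rightarrow> real" and R
    using integrable_real_mult_indicator[OF E_C[OF that(2)] that(1)] by (simp add: mult.commute)
  have g_E: "(\<integral>\<omega>. indicator (E \<theta>0 R) \<omega> * ?g R \<omega> \<partial>completion P) = p \<theta>0 R * d R + p' R * f \<theta>0 R"
    if R: "R \<in> \<R>" for R
  proof -
    have "(\<integral>\<omega>. indicator (E \<theta>0 R) \<omega> * F \<theta>0 \<omega> R \<partial>completion P) = p \<theta>0 R * f \<theta>0 R"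
      using F_E[OF \<theta>0 R] F_meas[OF \<theta>0 R] E_sets[OF \<theta>0 R] by (subst integral_completion) auto
    moreover have "(\<integral>\<omega>. indicator (E \<theta>0 R) \<omega> * ?g R \<omega> \<partial>completion P)
        = (\<integral>\<omega>. indicator (E \<theta>0 R) \<omega> * D R \<omega> \<partial>completion P)
          + (\<integral>\<omega>. indicator (E \<theta>0 R) \<omega> * F \<theta>0 \<omega> R \<partial>completion P) * s R"
      using restrict[OF D_integrable[OF R] R] restrict[OF F_C[OF R] R]
      by (simp add: distrib_left mult.assoc[symmetric])
    \<comment> \<open>The probability \<open>p \<theta>0 R\<close> cancels the denominator of the
      logarithmic derivative, so that \<open>p \<theta>0 R * s R = p' R\<close>.\<close>
    ultimately show ?thesis
      using D_E[OF R] p_pos[OF \<theta>0 R] by (simp add: s_eq[OF R])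
  qed
  \<comment> \<open>The bound is shaped after \<open>terms_dominated\<close>: its first summand
    matches the first inequality there, its second the limit of the second inequality divided by the
    distance to \<open>\<theta>0\<close>.\<close>
  have g_abs: "(\<integral>\<omega>. \<bar>indicator (E \<theta>0 R) \<omega> * ?g R \<omega>\<bar> \<partial>completion P)
      \<le> p \<theta>0 R * L R + \<bar>p' R\<bar> * (\<integral>\<omega>. \<bar>F \<theta>0 \<omega> R\<bar> \<partial>P)" if R: "R \<in> \<R>" for R
  proof -
    have int: "integrable (completion P) (\<lambda>\<omega>. indicator (E \<theta>0 R) \<omega> * \<bar>D R \<omega>\<bar>)"
      "integrable (completion P) (\<lambda>\<omega>. indicator (E \<theta>0 R) \<omega> * \<bar>F \<theta>0 \<omega> R\<bar>)"
      using D_integrable[OF R] F_C[OF R] by (intro restrict R integrable_abs; simp)+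
    have "(\<integral>\<omega>. \<bar>indicator (E \<theta>0 R) \<omega> * ?g R \<omega>\<bar> \<partial>completion P)
        \<le> (\<integral>\<omega>. indicator (E \<theta>0 R) \<omega> * \<bar>D R \<omega>\<bar> + indicator (E \<theta>0 R) \<omega> * \<bar>F \<theta>0 \<omega> R\<bar> * \<bar>s R\<bar>
            \<partial>completion P)"
    proof (rule integral_mono)
      show "integrable (completion P) (\<lambda>\<omega>. \<bar>indicator (E \<theta>0 R) \<omega> * ?g R \<omega>\<bar>)"
        using D_integrable[OF R] F_C[OF R] by (intro integrable_abs restrict R) auto
      show "\<bar>indicator (E \<theta>0 R) \<omega> * ?g R \<omega>\<bar>
        \<le> indicator (E \<theta>0 R) \<omega> * \<bar>D R \<omega>\<bar> + indicator (E \<theta>0 R) \<omega> * \<bar>F \<theta>0 \<omega> R\<bar> * \<bar>s R\<bar>" for \<omega>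
        using abs_triangle_ineq[of "D R \<omega>" "F \<theta>0 \<omega> R * s R"]
        by (auto simp: indicator_def abs_mult)
    qed (use int in auto)
    also have "\<dots> = p \<theta>0 R * (\<integral>\<omega>. \<bar>D R \<omega>\<bar> \<partial>completion P)
        + (\<integral>\<omega>. indicator (E \<theta>0 R) \<omega> * \<bar>F \<theta>0 \<omega> R\<bar> \<partial>completion P) * \<bar>s R\<bar>"
      using int D_E_abs[OF R] by simp
    also have "(\<integral>\<omega>. indicator (E \<theta>0 R) \<omega> * \<bar>F \<theta>0 \<omega> R\<bar> \<partial>completion P) * \<bar>s R\<bar>
        = \<bar>p' R\<bar> * (\<integral>\<omega>. \<bar>F \<theta>0 \<omega> R\<bar> \<partial>P)"
      using F_E_abs[OF \<theta>0 R] F_meas[OF \<theta>0 R] E_sets[OF \<theta>0 R] p_pos[OF \<theta>0 R]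
      by (subst integral_completion) (auto simp: s_eq[OF R] abs_divide)
    also have "p \<theta>0 R * (\<integral>\<omega>. \<bar>D R \<omega>\<bar> \<partial>completion P) \<le> p \<theta>0 R * L R"
      using D_abs[OF R] p_pos[OF \<theta>0 R] by simp
    finally show ?thesis by simp
  qed
  have g_summable: "integrable (count_space \<R>)
      (\<lambda>R. \<integral>\<omega>. \<bar>indicator (E \<theta>0 R) \<omega> * ?g R \<omega>\<bar> \<partial>completion P)"
  proof (cases "finite \<R>")
    case True
    then show ?thesis by (rule integrable_count_space)
  next
    case False
    from domE[OF this] obtain b \<delta> where \<delta>: "\<delta> > 0" and b: "integrable (count_space \<R>) b"
      and dom1: "\<And>R t. R \<in> \<R> \<Longrightarrow> t \<in> \<Theta> \<Longrightarrow> \<bar>t - \<theta>0\<bar> < \<delta> \<Longrightarrow> p t R * L R \<le> b R"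
      and dom2: "\<And>R t. R \<in> \<R> \<Longrightarrow> t \<in> \<Theta> \<Longrightarrow> \<bar>t - \<theta>0\<bar> < \<delta> \<Longrightarrow>
          \<bar>p t R - p \<theta>0 R\<bar> * (\<integral>\<omega>. \<bar>F \<theta>0 \<omega> R\<bar> \<partial>P) \<le> b R * \<bar>t - \<theta>0\<bar>"
      by blast
    have "\<theta>0 islimpt \<Theta> \<inter> ball \<theta>0 \<delta>"
      using limpt \<delta> by (rule islimpt_Int_ball)
    then obtain u where u: "\<And>n. u n \<in> \<Theta> \<inter> ball \<theta>0 \<delta> - {\<theta>0}" "u \<longlonglongrightarrow> \<theta>0"
      unfolding islimpt_sequential by blast
    \<comment> \<open>By \<open>dom2\<close> the difference quotients of \<open>p\<close>, weighted
      by this mean, are at most \<open>b R\<close> near \<open>\<theta>0\<close>; along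
      \<open>u\<close> the bound passes to the derivative \<open>p' R\<close>.\<close>
    have "\<bar>p' R\<bar> * (\<integral>\<omega>. \<bar>F \<theta>0 \<omega> R\<bar> \<partial>P) \<le> b R" if R: "R \<in> \<R>" for R
    proof -
      let ?c = "\<integral>\<omega>. \<bar>F \<theta>0 \<omega> R\<bar> \<partial>P"
      have "\<bar>p' R * ?c\<bar> \<le> b R"
      proof (rule abs_derivative_le_of_sequence)
        show "((\<lambda>t. p t R * ?c) has_real_derivative p' R * ?c) (at \<theta>0 within \<Theta>)"
          using p_deriv[OF R] by (rule DERIV_cmult_right)
        show "u n \<in> \<Theta> - {\<theta>0}" for n using u(1)[of n] by simp
        show "\<bar>p (u n) R * ?c - p \<theta>0 R * ?c\<bar> \<le> b R * \<bar>u n - \<theta>0\<bar>" for n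
          using dom2[OF R, of "u n"] u(1)[of n]
          by (simp add: left_diff_distrib[symmetric] abs_mult dist_real_def abs_minus_commute)
      qed (rule u(2))
      then show ?thesis by (simp add: abs_mult)
    qed
    \<comment> \<open>The other inequality of the domination, taken at \<open>\<theta>0\<close>
      itself.\<close>
    moreover have "p \<theta>0 R * L R \<le> b R" if "R \<in> \<R>" for R
      using dom1[OF that \<theta>0] \<delta> by simp
    ultimately have le: "(\<integral>\<omega>. \<bar>indicator (E \<theta>0 R) \<omega> * ?g R \<omega>\<bar> \<partial>completion P) \<le> 2 * b R"
      if "R \<in> \<R>" for R
      using g_abs[OF that] that by fastforce
    have "norm (\<integral>\<omega>. \<bar>indicator (E \<theta>0 R) \<omega> * ?g R \<omega>\<bar> \<partial>completion P) \<le> norm (2 * b R)"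
      if "R \<in> \<R>" for R
      unfolding real_norm_def
      by (subst abs_of_nonneg, simp, rule order_trans[OF le[OF that] abs_ge_self])
    then show ?thesis
      by (intro Bochner_Integration.integrable_bound[OF integrable_mult_right[of 2, OF b]])
        (simp_all add: AE_count_space)
  qed

  have G_eq: "grad_sample P \<Theta> F Rt \<theta>0 = (\<lambda>\<omega>. ?g (Rt \<theta>0 \<omega>) \<omega>)"
    by (simp add: fun_eq_iff grad_sample_def D_def s_def)
  have g_int: "integrable (completion P) (?g R)" if "R \<in> \<R>" for R
    using D_integrable[OF that] F_C[OF that] by auto
  note part = C.sigma_finite_measure_axioms \<R>_countable measurable_completion[OF Rt_count[OF \<theta>0]]
    borel_measurable_integrable[OF g_int]
  have G_int: "integrable (completion P) (grad_sample P \<Theta> F Rt \<theta>0)"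
    unfolding G_eq
  proof (rule integrable_partition[where g = ?g, OF part])
    show "integrable (completion P) (\<lambda>\<omega>. indicator (Rt \<theta>0 -` {R} \<inter> space (completion P)) \<omega> * ?g R \<omega>)"
      if "R \<in> \<R>" for R
      using restrict[OF g_int[OF that] that] by (simp add: E_def)
    show "integrable (count_space \<R>) (\<lambda>R. \<integral>\<omega>.
        \<bar>indicator (Rt \<theta>0 -` {R} \<inter> space (completion P)) \<omega> * ?g R \<omega>\<bar> \<partial>completion P)"
      using g_summable by (simp add: E_def)
  qed
  have G_mean: "(\<integral>\<omega>. grad_sample P \<Theta> F Rt \<theta>0 \<omega> \<partial>completion P)
      = (\<integral>R. p \<theta>0 R * d R + p' R * f \<theta>0 R \<partial>count_space \<R>)"
    using integral_partition[where g = ?g, OF part G_int[unfolded G_eq]] unfolding G_eq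
    by (simp only: space_completion E_def[symmetric])
      (rule Bochner_Integration.integral_cong, simp_all only: g_E space_count_space)

  \<comment> \<open>Averaging over the realizations\<close>
  have X_C: "integrable (completion S) (\<lambda>w. grad_sample P \<Theta> F Rt \<theta>0 (X i w))"
      "(\<integral>w. grad_sample P \<Theta> F Rt \<theta>0 (X i w) \<partial>completion S)
        = (\<integral>\<omega>. grad_sample P \<Theta> F Rt \<theta>0 \<omega> \<partial>completion P)" if i: "i \<in> {1..m}" for i
  proof -
    have "X i \<in> S \<rightarrow>\<^sub>M P"
      using X_indep i by (auto simp: S.indep_vars_def)
    note X = distr_completion_completion[OF this X_law[OF i]]
    show "integrable (completion S) (\<lambda>w. grad_sample P \<Theta> F Rt \<theta>0 (X i w))"
      using G_int by (intro integrable_distr[OF X(1)]) (simp add: X(2))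
    show "(\<integral>w. grad_sample P \<Theta> F Rt \<theta>0 (X i w) \<partial>completion S)
        = (\<integral>\<omega>. grad_sample P \<Theta> F Rt \<theta>0 \<omega> \<partial>completion P)"
      using integral_distr[OF X(1) borel_measurable_integrable[OF G_int]] by (simp add: X(2))
  qed
  have "integrable (completion S) (\<lambda>w. grad_estimate P \<Theta> F Rt \<theta>0 m (\<lambda>i. X i w))"
    unfolding grad_estimate_def
    by (intro integrable_mult_right Bochner_Integration.integrable_sum X_C(1))
  moreover have "(\<integral>w. grad_estimate P \<Theta> F Rt \<theta>0 m (\<lambda>i. X i w) \<partial>completion S)
      = (\<integral>R. p \<theta>0 R * d R + p' R * f \<theta>0 R \<partial>count_space \<R>)"
    \<comment> \<open>All \<open>m\<close> summands have the same mean, and \<open>m\<close> being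
      positive, the factor \<open>1 / real m\<close> cancels their number.\<close>
    using m X_C unfolding grad_estimate_def by (simp add: Bochner_Integration.integral_sum G_mean)
  ultimately show ?thesis
    using deriv by simp
qed

end
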